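(* Let $X$ and $Y$ be sets, let $\tau$ and $\rho$ be Hausdorff topologies on $X$ with $\rho$ finer than $\tau$, and let $\tau'$ and $\rho'$ be Hausdorff topologies on $Y$ with $\rho'$ finer than $\tau'$. Suppose that $X$ is $\sigma$-$(\tau,\rho)$-LRC, and let $\pi : X \to Y$ be a surjective map that is perfect as a map from $(X,\tau)$ to $(Y,\tau')$ and continuous as a map from $(X,\rho)$ to $(Y,\rho')$. Then $Y$ is $\sigma$-$(\tau',\rho')$-LRC.
   Context: Let $X$ be a set with two Hausdorff topologies $\tau$ and $\rho$, with $\rho$ finer than $\tau$. A subset $E \subseteq X$ is called $(\tau,\rho)$-LRC ($\tau$-locally relatively $\rho$-compact) if for every $x \in E$ there is a $\tau$-open set $U \subseteq X$ with $x \in U$ such that the $\rho$-closure $\overline{E \cap U}^{\rho}$ is $\rho$-compact. A subset $E\subseteq X$ is called $\sigma$-$(\tau,\rho)$-LRC if it is a countable union of $(\tau,\rho)$-LRC sets. The same definitions apply to $(Y,\tau',\rho')$. A map between topological spaces is perfect if it is continuous, closed (images of closed sets are closed) and has compact fibres. *)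

theory Defs
  imports "HOL-Analysis.Analysis"
begin

text \<open>In the following definitions \<open>\<tau>\<close> and \<open>\<rho>\<close> are meant to be topologies on the same set
  \<open>topspace \<tau> = topspace \<rho>\<close>, with \<open>\<rho>\<close> finer than \<open>\<tau>\<close>.\<close>

definition LRC :: "'a topology \<Rightarrow> 'a topology \<Rightarrow> 'a set \<Rightarrow> bool" where
  "LRC \<tau> \<rho> E \<longleftrightarrow>
     E \<subseteq> topspace \<tau> \<and>
     (\<forall>x\<in>E. \<exists>U. openin \<tau> U \<and> x \<in> U \<and> compactin \<rho> (\<rho> closure_of (E \<inter> U)))"

definition sigma_LRC :: "'a topology \<Rightarrow> 'a topology \<Rightarrow> 'a set \<Rightarrow> bool" where
  "sigma_LRC \<tau> \<rho> E \<longleftrightarrow>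
     (\<exists>\<E>. countable \<E> \<and> (\<forall>A\<in>\<E>. LRC \<tau> \<rho> A) \<and> E = \<Union>\<E>)"

end

theory Submission
  imports Defs
begin

text \<open>Closed LRC sets are easily transported along a perfect map \<open>\<pi>\<close>: if \<open>X\<close> is the union of
  \<open>\<tau>\<close>-closed LRC sets \<open>C 1, C 2, \<dots>\<close>, then the points \<open>y\<close> for which \<open>n\<close> is the least index such
  that the fibre over \<open>y\<close> meets \<open>C n\<close> form an LRC set, because the compact set \<open>fibre \<inter> C n\<close> has a
  neighbourhood in which \<open>C n\<close> is relatively \<open>\<rho>\<close>-compact and, \<open>\<pi>\<close> being closed, this neighbourhood
  still contains the part in \<open>C n\<close> of all nearby fibres.

  In general an LRC set can only be enlarged to a \<^emph>\<open>locally closed\<close> LRC set \<open>C - D\<close>, with \<open>C\<close> and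
  \<open>D\<close> both \<open>\<tau>\<close>-closed (lemma \<open>LRC_locally_closed_superset\<close>).  The argument above still applies to
  the points \<open>y\<close> whose fibre meets \<open>C\<close> but not \<open>D\<close>, that is, to \<open>\<pi> ` C - \<pi> ` D\<close>
  (lemma \<open>LRC_image_diff\<close>).  For fibres that meet the remainders \<open>D\<close> as well, everything is
  intersected with finitely many remainders: for a finite set \<open>s\<close> of indices and an index \<open>i\<close>, put
  \<open>B = \<Inter>(D ` s)\<close> and consider \<open>\<pi> ` (B \<inter> C i) - \<pi> ` (B \<inter> D i)\<close>.  There are only countably many
  pairs \<open>(s, i)\<close>, and each of these images is LRC.  They cover \<open>Y\<close> by the combinatorial lemma
  \<open>compactin_meets_finite_remainder\<close>: if a fibre escaped all of them, one could keep intersecting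
  it with remainders without ever reaching the empty set, and by compactness some point of the
  fibre would lie in none of the sets \<open>C i - D i\<close>.\<close>

section \<open>LRC sets\<close>

lemma LRC_subset:
  assumes "LRC \<tau> \<rho> E" and "E' \<subseteq> E"
  shows "LRC \<tau> \<rho> E'"
  unfolding LRC_def
proof (intro conjI ballI)
  show "E' \<subseteq> topspace \<tau>"
    using assms by (auto simp: LRC_def)
next
  fix x assume "x \<in> E'"
  then obtain U where U: "openin \<tau> U" "x \<in> U" "compactin \<rho> (\<rho> closure_of (E \<inter> U))"
    using assms unfolding LRC_def by blast
  have "\<rho> closure_of (E' \<inter> U) \<subseteq> \<rho> closure_of (E \<inter> U)"
    using assms(2) by (intro closure_of_mono) auto
  then have "compactin \<rho> (\<rho> closure_of (E' \<inter> U))"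
    by (rule closed_compactin[OF U(3) _ closedin_closure_of])
  then show "\<exists>U. openin \<tau> U \<and> x \<in> U \<and> compactin \<rho> (\<rho> closure_of (E' \<inter> U))"
    using U by blast
qed

lemma LRC_compact_nbhd:
  assumes E: "LRC \<tau> \<rho> E" and K: "compactin \<tau> K" and "K \<subseteq> E"
  shows "\<exists>U. openin \<tau> U \<and> K \<subseteq> U \<and> compactin \<rho> (\<rho> closure_of (E \<inter> U))"
proof -
  define \<U> where "\<U> = {U. openin \<tau> U \<and> compactin \<rho> (\<rho> closure_of (E \<inter> U))}"
  have "K \<subseteq> \<Union>\<U>"
    using E \<open>K \<subseteq> E\<close> unfolding LRC_def \<U>_def by blast
  then have "\<exists>\<F>. finite \<F> \<and> \<F> \<subseteq> \<U> \<and> K \<subseteq> \<Union>\<F>"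
    by (intro compactinD[OF K]) (auto simp: \<U>_def)
  then obtain \<F> where \<F>: "finite \<F>" "\<F> \<subseteq> \<U>" "K \<subseteq> \<Union>\<F>"
    by blast
  have "E \<inter> \<Union>\<F> = \<Union>((\<inter>) E ` \<F>)"
    by blast
  then have "\<rho> closure_of (E \<inter> \<Union>\<F>) = (\<Union>U\<in>\<F>. \<rho> closure_of (E \<inter> U))"
    by (simp only: closure_of_Union[OF finite_imageI[OF \<F>(1)]] image_image)
  moreover have "compactin \<rho> (\<Union>U\<in>\<F>. \<rho> closure_of (E \<inter> U))"
    using \<F>(1,2) by (intro compactin_Union) (auto simp: \<U>_def)
  moreover have "openin \<tau> (\<Union>\<F>)"
    using \<F>(2) by (auto simp: \<U>_def)
  ultimately show ?thesis
    using \<F>(3) by metis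
qed

text \<open>The compact set \<open>\<rho> closure_of (E \<inter> U)\<close> is also \<open>\<tau>\<close>-compact, hence \<open>\<tau>\<close>-closed, so it contains
  \<open>U \<inter> \<tau> closure_of E\<close>.  Therefore the neighbourhoods \<open>U\<close> that witness LRC for \<open>E\<close> witness it for
  the part of the \<open>\<tau>\<close>-closure of \<open>E\<close> that they cover.\<close>

lemma LRC_locally_closed_superset:
  assumes "Hausdorff_space \<tau>" and top: "topspace \<rho> = topspace \<tau>"
    and finer: "\<And>U. openin \<tau> U \<Longrightarrow> openin \<rho> U"
    and E: "LRC \<tau> \<rho> E"
  shows "\<exists>C D. closedin \<tau> C \<and> closedin \<tau> D \<and> E \<subseteq> C - D \<and> LRC \<tau> \<rho> (C - D)"
proof -
  define \<U> where "\<U> = {U. openin \<tau> U \<and> compactin \<rho> (\<rho> closure_of (E \<inter> U))}"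
  define C where "C = \<tau> closure_of E"
  define D where "D = topspace \<tau> - \<Union>\<U>"
  have sub: "E \<subseteq> topspace \<tau>"
    using E by (simp add: LRC_def)
  have "openin \<tau> (\<Union>\<U>)"
    by (auto simp: \<U>_def)
  then have "closedin \<tau> C" "closedin \<tau> D"
    by (auto simp: C_def D_def)
  moreover have "E \<subseteq> C - D"
    using E closure_of_subset[OF sub] unfolding LRC_def C_def D_def \<U>_def by blast
  moreover have "LRC \<tau> \<rho> (C - D)"
    unfolding LRC_def
  proof (intro conjI ballI)
    show "C - D \<subseteq> topspace \<tau>"
      using \<open>closedin \<tau> C\<close> closedin_subset by blast
  next
    fix x assume x: "x \<in> C - D"
    then have "x \<in> \<Union>\<U>"
      using \<open>closedin \<tau> C\<close> closedin_subset unfolding D_def by blast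
    then obtain U where U: "openin \<tau> U" "x \<in> U" "compactin \<rho> (\<rho> closure_of (E \<inter> U))"
      by (auto simp: \<U>_def)
    let ?K = "\<rho> closure_of (E \<inter> U)"
    have "compactin \<tau> ?K"
      using compactin_contractive[OF U(3) top finer] by simp
    then have "closedin \<tau> ?K"
      using assms(1) compactin_imp_closedin by blast
    moreover have "E \<inter> U \<subseteq> ?K"
      using sub top by (intro closure_of_subset) auto
    ultimately have "\<tau> closure_of (U \<inter> E) \<subseteq> ?K"
      by (simp add: closure_of_minimal Int_commute)
    then have "(C - D) \<inter> U \<subseteq> ?K"
      using openin_Int_closure_of_subset[OF U(1), of E] by (auto simp: C_def)
    then have "\<rho> closure_of ((C - D) \<inter> U) \<subseteq> ?K"
      by (simp add: closure_of_minimal)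
    then have "compactin \<rho> (\<rho> closure_of ((C - D) \<inter> U))"
      by (rule closed_compactin[OF U(3) _ closedin_closure_of])
    then show "\<exists>U. openin \<tau> U \<and> x \<in> U \<and> compactin \<rho> (\<rho> closure_of ((C - D) \<inter> U))"
      using U by blast
  qed
  ultimately show ?thesis by blast
qed

section \<open>Images under perfect maps\<close>

text \<open>A point \<open>y\<close> of \<open>\<pi> ` C - \<pi> ` D\<close> is one whose fibre meets \<open>C\<close>, but only inside \<open>C - D\<close>.  Hence
  \<open>fibre \<inter> C\<close> is a compact subset of an LRC set and has a neighbourhood \<open>U\<close> on which \<open>C - D\<close> is
  relatively \<open>\<rho>\<close>-compact; since \<open>\<pi>\<close> is closed, fibres near \<open>y\<close> meet \<open>C\<close> only within \<open>U\<close>.\<close>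

lemma LRC_image_diff:
  assumes \<rho>: "topspace \<rho> = topspace \<tau>" and "Hausdorff_space \<rho>'"
    and \<pi>: "perfect_map \<tau> \<tau>' \<pi>" and cont: "continuous_map \<rho> \<rho>' \<pi>"
    and C: "closedin \<tau> C" and D: "closedin \<tau> D" and E: "LRC \<tau> \<rho> (C - D)"
  shows "LRC \<tau>' \<rho>' (\<pi> ` C - \<pi> ` D)"
proof -
  have closed_image: "closedin \<tau>' (\<pi> ` A)" if "closedin \<tau> A" for A
    using \<pi> that by (auto simp: perfect_map_def proper_map_def closed_map_def)
  show ?thesis
    unfolding LRC_def
  proof (intro conjI ballI)
    show "\<pi> ` C - \<pi> ` D \<subseteq> topspace \<tau>'"
      using closedin_subset[OF closed_image[OF C]] by auto
  next
    fix y assume y: "y \<in> \<pi> ` C - \<pi> ` D"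
    then have "y \<in> topspace \<tau>'"
      using closedin_subset[OF closed_image[OF C]] by auto
    then have "compactin \<tau> {x \<in> topspace \<tau>. \<pi> x = y}"
      using \<pi> by (auto simp: perfect_map_def proper_map_def)
    then have "compactin \<tau> ({x \<in> topspace \<tau>. \<pi> x = y} \<inter> C)"
      using C compact_Int_closedin by blast
    moreover have "{x \<in> topspace \<tau>. \<pi> x = y} \<inter> C \<subseteq> C - D"
      using y by blast
    ultimately obtain U where U: "openin \<tau> U" "{x \<in> topspace \<tau>. \<pi> x = y} \<inter> C \<subseteq> U"
        "compactin \<rho> (\<rho> closure_of ((C - D) \<inter> U))"
      using LRC_compact_nbhd[OF E] by metis
    define K where "K = \<rho> closure_of ((C - D) \<inter> U)"
    define V where "V = topspace \<tau>' - \<pi> ` (C - U)"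
    have "openin \<tau>' V"
      unfolding V_def using C U(1) by (intro openin_diff closed_image closedin_diff) auto
    moreover have "y \<in> V"
      using \<open>y \<in> topspace \<tau>'\<close> U(2) closedin_subset[OF C] by (auto simp: V_def)
    moreover have "compactin \<rho>' (\<rho>' closure_of ((\<pi> ` C - \<pi> ` D) \<inter> V))"
    proof -
      have "(C - D) \<inter> U \<subseteq> K"
        unfolding K_def using closedin_subset[OF C] \<rho> by (intro closure_of_subset) auto
      then have "(\<pi> ` C - \<pi> ` D) \<inter> V \<subseteq> \<pi> ` K"
        by (auto simp: V_def)
      moreover have "compactin \<rho>' (\<pi> ` K)"
        using image_compactin[OF U(3) cont] by (simp add: K_def)
      moreover from this have "closedin \<rho>' (\<pi> ` K)"
        using assms(2) compactin_imp_closedin by blast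
      ultimately show ?thesis
        by (metis closed_compactin closedin_closure_of closure_of_minimal)
    qed
    ultimately show "\<exists>V. openin \<tau>' V \<and> y \<in> V \<and>
        compactin \<rho>' (\<rho>' closure_of ((\<pi> ` C - \<pi> ` D) \<inter> V))"
      by blast
  qed
qed

section \<open>Locally closed covers of a compact set\<close>

text \<open>Take a maximal set \<open>S\<close> of indices for which all finite intersections of the remainders \<open>D i\<close>
  meet \<open>F\<close>.  By compactness some \<open>z \<in> F\<close> lies in every \<open>D i\<close> with \<open>i \<in> S\<close>.  If \<open>z \<in> C i - D i\<close>, then
  \<open>i \<notin> S\<close>, and maximality gives a finite part \<open>s\<close> of \<open>S\<close> whose intersection no longer meets
  \<open>F \<inter> D i\<close>, whereas it meets \<open>F \<inter> C i\<close> in \<open>z\<close>.\<close>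

lemma compactin_meets_finite_remainder:
  assumes F: "compactin \<tau> F" "F \<noteq> {}"
    and D: "\<And>i. i \<in> I \<Longrightarrow> closedin \<tau> (D i)"
    and cover: "F \<subseteq> (\<Union>i\<in>I. C i - D i)"
  obtains s i where "finite s" "s \<subseteq> I" "i \<in> I"
    "F \<inter> \<Inter>(D ` s) \<inter> C i \<noteq> {}" "F \<inter> \<Inter>(D ` s) \<inter> D i = {}"
proof -
  define \<A> where "\<A> = {S. S \<subseteq> I \<and> (\<forall>s. finite s \<and> s \<subseteq> S \<longrightarrow> F \<inter> \<Inter>(D ` s) \<noteq> {})}"
  have "\<exists>S\<in>\<A>. \<forall>S'\<in>\<A>. S \<subseteq> S' \<longrightarrow> S' = S"
  proof (rule subset_Zorn_nonempty)
    show "\<A> \<noteq> {}"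
      using F(2) by (auto simp: \<A>_def)
  next
    fix \<C> assume \<C>: "\<C> \<noteq> {}" "subset.chain \<A> \<C>"
    have "F \<inter> \<Inter>(D ` s) \<noteq> {}" if s: "finite s" "s \<subseteq> \<Union>\<C>" for s
    proof -
      obtain S where "S \<in> \<C>" "s \<subseteq> S"
        using finite_subset_Union_chain[OF s \<C>] by blast
      then show ?thesis
        using \<C>(2) s(1) by (auto simp: \<A>_def subset.chain_def)
    qed
    then show "\<Union>\<C> \<in> \<A>"
      using \<C>(2) by (auto simp: \<A>_def subset.chain_def)
  qed
  then obtain S where S: "S \<in> \<A>" and max: "\<And>S'. S' \<in> \<A> \<Longrightarrow> S \<subseteq> S' \<Longrightarrow> S' = S"
    by blast
  have "F \<inter> \<Inter>\<F> \<noteq> {}" if "finite \<F>" "\<F> \<subseteq> D ` S" for \<F>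
    using finite_subset_image[OF that] S by (auto simp: \<A>_def)
  moreover have "\<forall>B\<in>D ` S. closedin \<tau> B"
    using S D by (auto simp: \<A>_def)
  ultimately have "F \<inter> \<Inter>(D ` S) \<noteq> {}"
    using F(1) unfolding compactin_fip by blast
  then obtain z where z: "z \<in> F" "z \<in> \<Inter>(D ` S)"
    by blast
  then obtain i where i: "i \<in> I" "z \<in> C i" "z \<notin> D i"
    using cover by blast
  then have "i \<notin> S"
    using z by blast
  then have "insert i S \<notin> \<A>"
    using max[of "insert i S"] by blast
  then obtain t where t: "finite t" "t \<subseteq> insert i S" "F \<inter> \<Inter>(D ` t) = {}"
    using S i(1) unfolding \<A>_def by blast
  show thesis
  proof (rule that[of "t - {i}" i])
    show "finite (t - {i})" "t - {i} \<subseteq> I" "i \<in> I"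
      using t S i by (auto simp: \<A>_def)
    have "z \<in> \<Inter>(D ` (t - {i}))"
      using z(2) t(2) by blast
    then show "F \<inter> \<Inter>(D ` (t - {i})) \<inter> C i \<noteq> {}"
      using z(1) i(2) by blast
    show "F \<inter> \<Inter>(D ` (t - {i})) \<inter> D i = {}"
      using t(3) by blast
  qed
qed

section \<open>Perfect images of \<open>\<sigma>\<close>-LRC spaces\<close>

theorem theorem2p2:
  fixes X :: "'a set" and Y :: "'b set"
    and \<tau> \<rho> :: "'a topology" and \<tau>' \<rho>' :: "'b topology"
    and \<pi> :: "'a \<Rightarrow> 'b"
  assumes "topspace \<tau> = X" and "topspace \<rho> = X"
    and "Hausdorff_space \<tau>" and "Hausdorff_space \<rho>"
    and "\<And>U. openin \<tau> U \<Longrightarrow> openin \<rho> U"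
    and "topspace \<tau>' = Y" and "topspace \<rho>' = Y"
    and "Hausdorff_space \<tau>'" and "Hausdorff_space \<rho>'"
    and "\<And>V. openin \<tau>' V \<Longrightarrow> openin \<rho>' V"
    and "sigma_LRC \<tau> \<rho> X"
    and "\<pi> ` X = Y"
    and "perfect_map \<tau> \<tau>' \<pi>"
    and "continuous_map \<rho> \<rho>' \<pi>"
  shows "sigma_LRC \<tau>' \<rho>' Y"
proof -
  obtain \<E> where \<E>: "countable \<E>" "\<And>E. E \<in> \<E> \<Longrightarrow> LRC \<tau> \<rho> E" "X = \<Union>\<E>"
    using assms(11) unfolding sigma_LRC_def by blast
  have "\<exists>C D. closedin \<tau> C \<and> closedin \<tau> D \<and> E \<subseteq> C - D \<and> LRC \<tau> \<rho> (C - D)" if "E \<in> \<E>" for E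
    using LRC_locally_closed_superset[OF assms(3) _ assms(5) \<E>(2)[OF that]] assms(1,2) by simp
  then obtain C D where CD: "\<And>E. E \<in> \<E> \<Longrightarrow> closedin \<tau> (C E)" "\<And>E. E \<in> \<E> \<Longrightarrow> closedin \<tau> (D E)"
      "\<And>E. E \<in> \<E> \<Longrightarrow> E \<subseteq> C E - D E" "\<And>E. E \<in> \<E> \<Longrightarrow> LRC \<tau> \<rho> (C E - D E)"
    by metis
  \<comment> \<open>Intersecting with \<open>X\<close> matters only for \<open>s = {}\<close>, where \<open>\<Inter>(D ` s)\<close> is the whole type.\<close>
  define B where "B s = X \<inter> \<Inter>(D ` s)" for s
  define A where "A = (\<lambda>(s, E). \<pi> ` (B s \<inter> C E) - \<pi> ` (B s \<inter> D E))"
  define P where "P = {s. finite s \<and> s \<subseteq> \<E>} \<times> \<E>"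
  have "countable P"
    unfolding P_def using \<E>(1) by (intro countable_SIGMA countable_Collect_finite_subset)
  moreover have LRC_A: "LRC \<tau>' \<rho>' (A p)" if p_in: "p \<in> P" for p
  proof -
    obtain s E where p: "p = (s, E)" "finite s" "s \<subseteq> \<E>" "E \<in> \<E>"
      using p_in by (auto simp: P_def)
    have "closedin \<tau> (\<Inter>(insert X (D ` s)))"
      using p(3) CD(2) assms(1) by (intro closedin_Inter) auto
    then have "closedin \<tau> (B s)"
      by (simp add: B_def)
    moreover have "LRC \<tau> \<rho> (B s \<inter> C E - B s \<inter> D E)"
      by (rule LRC_subset[OF CD(4)[OF p(4)]]) auto
    ultimately show ?thesis
      unfolding p(1) A_def prod.case using CD(1,2) p(4) assms(1,2,9,13,14)
      by (intro LRC_image_diff[of \<rho> \<tau>]) auto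
  qed
  moreover have "Y = \<Union>(A ` P)"
  proof
    show "\<Union>(A ` P) \<subseteq> Y"
      using LRC_A assms(6) by (auto simp: LRC_def)
  next
    show "Y \<subseteq> \<Union>(A ` P)"
    proof
      fix y assume "y \<in> Y"
      define F where "F = {x \<in> X. \<pi> x = y}"
      have compact: "compactin \<tau> F"
        using assms(1,6,13) \<open>y \<in> Y\<close> by (auto simp: F_def perfect_map_def proper_map_def)
      have nonempty: "F \<noteq> {}"
        using \<open>y \<in> Y\<close> assms(12) by (auto simp: F_def)
      have cover: "F \<subseteq> (\<Union>E\<in>\<E>. C E - D E)"
        using \<E>(3) CD(3) by (fastforce simp: F_def)
      obtain s E where s: "finite s" "s \<subseteq> \<E>" "E \<in> \<E>"
          "F \<inter> \<Inter>(D ` s) \<inter> C E \<noteq> {}" "F \<inter> \<Inter>(D ` s) \<inter> D E = {}"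
        by (rule compactin_meets_finite_remainder[OF compact nonempty CD(2) cover])
      have "y \<in> A (s, E)"
        using s(4,5) by (auto simp: A_def B_def F_def)
      then show "y \<in> \<Union>(A ` P)"
        using s(1-3) by (auto simp: P_def)
    qed
  qed
  ultimately show ?thesis
    unfolding sigma_LRC_def by (intro exI[of _ "A ` P"]) auto
qed

end
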